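(* Let $r,n$ be integers with $r\geq 3$ and $n\geq 2$, and let $G$ be a finite simple $K_{1,r}$-free graph. If $\delta(G)\geq \left\lfloor\frac{r+n-2}{n}\right\rfloor$, then $G$ has an $\mathcal{S}_n$-factor.
   Context: All graphs are finite and simple. $\delta(G)$ is the minimum degree of $G$. $K_{1,r}$ denotes the star with one center vertex adjacent to $r$ leaves. A graph $G$ is $K_{1,r}$-free if it contains no induced subgraph isomorphic to $K_{1,r}$. For a family $\mathcal{F}$ of connected graphs, an $\mathcal{F}$-factor of $G$ is a spanning subgraph $H$ of $G$ each of whose connected components is isomorphic to some graph in $\mathcal{F}$. An $\mathcal{S}_n$-factor is an $\mathcal{F}$-factor with $\mathcal{F}=\{K_{1,1},K_{1,2},\dots,K_{1,n}\}$ (where $K_{1,1}=K_2$). *)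

theory Defs
  imports "Graph_Theory.Graph_Theory"
begin

text \<open>
  A finite simple graph is an instance of the locale \<^locale>\<open>graph\<close>: a finite, loop-free,
  symmetric digraph without parallel arcs, in which each undirected edge is represented by a pair
  of opposite arcs. Hence the degree of a vertex is its out-degree, and the connected components
  are the strongly connected components. The predicate
  \<^const>\<open>complete_bipartite_digraph\<close> \<open>1 k\<close>, written \<open>K\<^bsub>1,k\<^esub>\<close>, states that its argument
  is isomorphic to the star with \<open>k\<close> leaves.
\<close>

text \<open>
  The minimum degree is unspecified for the graph without vertices.
\<close>
definition min_degree :: "('a, 'b) pre_digraph \<Rightarrow> nat" where
  "min_degree G = Min (out_degree G ` verts G)"

definition star_free :: "nat \<Rightarrow> ('a, 'b) pre_digraph \<Rightarrow> bool" where
  "star_free r G \<longleftrightarrow> \<not> (\<exists>H. induced_subgraph H G \<and> K\<^bsub>1,r\<^esub> H)"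

text \<open>
  A family of graphs is given by a predicate that is invariant under isomorphism.
  Since \<^const>\<open>spanning\<close> also admits subgraphs that contain only one of two opposite arcs,
  the factor is separately required to be a graph.
\<close>
definition is_factor ::
  "(('a, 'b) pre_digraph \<Rightarrow> bool) \<Rightarrow> ('a, 'b) pre_digraph \<Rightarrow> ('a, 'b) pre_digraph \<Rightarrow> bool" where
  "is_factor F H G \<longleftrightarrow> graph H \<and> spanning H G \<and> (\<forall>C \<in> pre_digraph.sccs H. F C)"

definition is_star_factor :: "nat \<Rightarrow> ('a, 'b) pre_digraph \<Rightarrow> ('a, 'b) pre_digraph \<Rightarrow> bool" where
  "is_star_factor n = is_factor (\<lambda>C. \<exists>k \<in> {1..n}. K\<^bsub>1,k\<^esub> C)"

end

theory Submission
  imports Defs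
begin

text \<open>
  Put \<open>d = \<lfloor>(r + n - 2) / n\<rfloor> = \<lceil>(r - 1) / n\<rceil>\<close>. If \<open>I\<close> is independent, each of its vertices has at
  least \<open>d\<close> neighbours, while each vertex of \<open>N(I)\<close> has at most \<open>r - 1\<close> neighbours in \<open>I\<close>, so
  \<open>d |I| \<le> (r - 1) |N(I)| \<le> d n |N(I)|\<close> and hence \<open>|I| \<le> n |N(I)|\<close>. On the other hand, take a packing
  of stars with at most \<open>n\<close> leaves that covers as many vertices as possible. If it misses a vertex
  \<open>u\<close>, then every neighbour of \<open>u\<close> is the centre of a star with exactly \<open>n\<close> leaves, and \<open>u\<close> can be
  exchanged for any of these leaves. The vertices that can be left uncovered by repeated exchanges
  form an independent set \<open>I\<close> with \<open>|I| > n |N(I)|\<close>.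
\<close>

section \<open>Encoding of star packings and exchanges\<close>

definition fibre :: "('a \<rightharpoonup> 'b) \<Rightarrow> 'b \<Rightarrow> 'a set" where
  "fibre m s = {x. m x = Some s}"

definition covered :: "('a \<rightharpoonup> 'a) \<Rightarrow> 'a set" where
  "covered m = dom m \<union> ran m"

text \<open>A packing of stars with at most \<open>n\<close> leaves is encoded by the partial map that sends each
  leaf to its centre; in a star with a single leaf, one of the two ends is chosen as the centre.\<close>
definition star_packing :: "('a \<times> 'a) set \<Rightarrow> nat \<Rightarrow> ('a \<rightharpoonup> 'a) \<Rightarrow> bool" where
  "star_packing E n m \<longleftrightarrow>
    (\<forall>x s. m x = Some s \<longrightarrow> (x, s) \<in> E \<and> m s = None) \<and> (\<forall>s. card (fibre m s) \<le> n)"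

definition max_star_packing :: "('a \<times> 'a) set \<Rightarrow> nat \<Rightarrow> ('a \<rightharpoonup> 'a) \<Rightarrow> bool" where
  "max_star_packing E n m \<longleftrightarrow> star_packing E n m \<and>
    (\<forall>m'. star_packing E n m' \<longrightarrow> card (covered m') \<le> card (covered m))"

text \<open>A sequence of exchanges that moves the uncovered vertex from \<open>u\<close> to the
  last argument. The packing is carried along because each exchange acts on the packing reached so
  far, not on \<open>m\<close>.\<close>

inductive alternating :: "('a \<times> 'a) set \<Rightarrow> ('a \<rightharpoonup> 'a) \<Rightarrow> 'a \<Rightarrow> ('a \<rightharpoonup> 'a) \<Rightarrow> 'a \<Rightarrow> bool"
  for E m u where
  base: "alternating E m u m u"
| step: "alternating E m u m' x \<Longrightarrow> (x, s) \<in> E \<Longrightarrow> m' y = Some s \<Longrightarrow>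
    alternating E m u (m'(x \<mapsto> s, y := None)) y"

section \<open>Maximum star packings: augmentation and exchange\<close>

locale finite_simple_relation =
  fixes V :: "'a set" and E :: "('a \<times> 'a) set"
  assumes finite_V: "finite V" and E_subset: "E \<subseteq> V \<times> V" and sym_E: "sym E" and irrefl_E: "irrefl E"
begin

lemma covered_subset: "star_packing E n m \<Longrightarrow> covered m \<subseteq> V"
  using E_subset unfolding star_packing_def covered_def dom_def ran_def by blast

lemma finite_covered: "star_packing E n m \<Longrightarrow> finite (covered m)"
  using covered_subset finite_V finite_subset by blast

lemma finite_fibre: "star_packing E n m \<Longrightarrow> finite (fibre m s)"
  by (rule finite_subset[OF _ finite_covered]) (auto simp: fibre_def covered_def)

lemma max_star_packing_exists: "\<exists>m. max_star_packing E n m"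
proof -
  have "star_packing E n Map.empty"
    by (simp add: star_packing_def fibre_def)
  moreover have "\<forall>m. star_packing E n m \<longrightarrow> card (covered m) \<le> card V"
    by (simp add: card_mono covered_subset finite_V)
  ultimately obtain m where "star_packing E n m"
    "\<forall>m'. star_packing E n m' \<longrightarrow> card (covered m') \<le> card (covered m)"
    \<comment> \<open>\<open>ex_has_greatest_nat\<close> expects a strict upper bound, hence the
      \<open>Suc\<close>.\<close>
    using ex_has_greatest_nat[of "star_packing E n" Map.empty "\<lambda>m. card (covered m)" "Suc (card V)"]
    by (auto simp: less_Suc_eq_le)
  then show ?thesis
    unfolding max_star_packing_def by blast
qed

lemma max_star_packing_no_extension:
  assumes max: "max_star_packing E n m" and x: "x \<notin> covered m"
    and m': "star_packing E n m'" and sub: "insert x (covered m) \<subseteq> covered m'"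
  shows False
proof -
  have "card (insert x (covered m)) \<le> card (covered m')"
    using card_mono finite_covered m' sub by blast
  then show False
    using max m' x finite_covered[of n m] unfolding max_star_packing_def by auto
qed

text \<open>Otherwise \<open>x\<close> could be covered too: a leaf \<open>s\<close> can become the
  centre of a star containing \<open>x\<close>, and a non-leaf \<open>s\<close> with fewer than
  \<open>n\<close> leaves, possibly none, can take \<open>x\<close> as a further leaf.\<close>

lemma max_star_packing_neighbour_full:
  assumes n: "n \<ge> 2" and max: "max_star_packing E n m" and x: "x \<notin> covered m" and xs: "(x, s) \<in> E"
  shows "m s = None" and "card (fibre m s) = n"
proof -
  have m: "star_packing E n m"
    using max by (simp add: max_star_packing_def)
  have edge: "(a, b) \<in> E" and centre: "m b = None" if "m a = Some b" for a b
    using m that by (auto simp: star_packing_def)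
  have card_le: "card (fibre m a) \<le> n" for a
    using m by (auto simp: star_packing_def)
  have ne: "x \<noteq> s"
    using xs irrefl_E by (auto simp: irrefl_def)
  have mx: "m x = None" and nx: "m a \<noteq> Some x" for a
    using x by (auto simp: covered_def dom_def ran_def)
  show none: "m s = None"
  proof (rule ccontr)
    assume "m s \<noteq> None"
    then obtain c where c: "m s = Some c" by auto
    have ns: "m a \<noteq> Some s" for a
      using centre c by fastforce
    have cx: "c \<noteq> x" and cs: "c \<noteq> s" and mc: "m c = None"
      using nx ns c centre by auto
    have sE: "(s, c) \<in> E" "(c, s) \<in> E"
      using edge c sym_E by (auto dest: symD)
    show False
    proof (cases "\<exists>y. y \<noteq> s \<and> m y = Some c")
      case True
      then obtain y where y: "y \<noteq> s" "m y = Some c" by blast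
      \<comment> \<open>The old star keeps the leaf \<open>y\<close>, so \<open>c\<close> stays
        covered when \<open>s\<close> leaves it to form an edge with \<open>x\<close>.\<close>
      define m' where "m' = m(s := None, x \<mapsto> s)"
      have sub: "fibre m' a \<subseteq> (if a = s then {x} else fibre m a)" for a
        using ns by (auto simp: m'_def fibre_def)
      have "card (fibre m' a) \<le> n" for a
      proof -
        have "card (fibre m' a) \<le> card (if a = s then {x} else fibre m a)"
          using finite_fibre[OF m] by (intro card_mono sub) simp
        also have "\<dots> \<le> n"
          using card_le n by simp
        finally show ?thesis .
      qed
      moreover have "\<forall>a b. m' a = Some b \<longrightarrow> (a, b) \<in> E \<and> m' b = None"
        using edge centre xs ne nx ns by (auto simp: m'_def)
      ultimately have "star_packing E n m'"
        by (simp add: star_packing_def)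
      moreover have "insert x (covered m) \<subseteq> covered m'"
      proof -
        have "m' x = Some s" "m' y = Some c"
          using y mx by (auto simp: m'_def)
        moreover have "m' a = m a" if "a \<noteq> s" "a \<noteq> x" for a
          using that by (simp add: m'_def)
        ultimately show ?thesis
          using c mx unfolding covered_def dom_def ran_def
          by (smt (verit, best) Un_iff insert_iff mem_Collect_eq option.distinct(1) option.inject subsetI)
      qed
      ultimately show False
        using max_star_packing_no_extension[OF max x] by blast
    next
      case False
      \<comment> \<open>The old star is the single edge between \<open>s\<close> and
        \<open>c\<close>. Recentred at \<open>s\<close>, it can also take \<open>x\<close>; the two
        leaves fit because \<open>n\<close> is at least 2.\<close>
      define m' where "m' = m(s := None, c \<mapsto> s, x \<mapsto> s)"
      have sub: "fibre m' a \<subseteq> (if a = s then {c, x} else fibre m a)" for a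
        using ns by (auto simp: m'_def fibre_def)
      have "card (fibre m' a) \<le> n" for a
      proof -
        have "card (fibre m' a) \<le> card (if a = s then {c, x} else fibre m a)"
          using finite_fibre[OF m] by (intro card_mono sub) simp
        also have "\<dots> \<le> n"
          using card_le n cx by simp
        finally show ?thesis .
      qed
      moreover have "\<forall>a b. m' a = Some b \<longrightarrow> (a, b) \<in> E \<and> m' b = None"
        using edge centre xs ne nx ns sE cs False by (auto simp: m'_def)
      ultimately have "star_packing E n m'"
        by (simp add: star_packing_def)
      moreover have "insert x (covered m) \<subseteq> covered m'"
      proof -
        have "m' x = Some s" "m' c = Some s"
          using cx by (auto simp: m'_def)
        moreover have "m' a = m a" if "a \<noteq> s" "a \<noteq> x" "a \<noteq> c" for a
          using that by (simp add: m'_def)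
        ultimately show ?thesis
          using c mx mc False unfolding covered_def dom_def ran_def
          by (smt (verit, best) Un_iff insert_iff mem_Collect_eq option.distinct(1) option.inject subsetI)
      qed
      ultimately show False
        using max_star_packing_no_extension[OF max x] by blast
    qed
  qed
  show "card (fibre m s) = n"
  proof (rule ccontr)
    assume "card (fibre m s) \<noteq> n"
    with card_le[of s] have less: "card (fibre m s) < n" by simp
    define m' where "m' = m(x \<mapsto> s)"
    have fib: "fibre m' a = (if a = s then insert x (fibre m a) else fibre m a)" for a
      using mx by (auto simp: m'_def fibre_def)
    have "card (fibre m' a) \<le> n" for a
      using card_le[of a] less finite_fibre[OF m, of s] by (auto simp: fib card_insert_if)
    moreover have "\<forall>a b. m' a = Some b \<longrightarrow> (a, b) \<in> E \<and> m' b = None"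
      using edge centre xs ne nx none by (auto simp: m'_def)
    ultimately have "star_packing E n m'"
      by (simp add: star_packing_def)
    moreover have "insert x (covered m) \<subseteq> covered m'"
      using mx by (auto simp: m'_def covered_def)
    ultimately show False
      using max_star_packing_no_extension[OF max x] by blast
  qed
qed

text \<open>\<open>x\<close> takes the place of the leaf \<open>y\<close> in the star at
  \<open>s\<close>, so star sizes are kept and the covered set only trades \<open>y\<close> for
  \<open>x\<close>.\<close>

lemma max_star_packing_swap:
  assumes max: "max_star_packing E n m" and x: "x \<notin> covered m" and xs: "(x, s) \<in> E" and y: "m y = Some s"
  defines "m' \<equiv> m(x \<mapsto> s, y := None)"
  shows "max_star_packing E n m'" and "y \<notin> covered m'" and "card (fibre m' a) = card (fibre m a)"
proof -
  have m: "star_packing E n m"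
    using max by (simp add: max_star_packing_def)
  have edge: "(a, b) \<in> E" and centre: "m b = None" if "m a = Some b" for a b
    using m that by (auto simp: star_packing_def)
  have ne: "x \<noteq> s"
    using xs irrefl_E by (auto simp: irrefl_def)
  have mx: "m x = None" and nx: "m a \<noteq> Some x" for a
    using x by (auto simp: covered_def dom_def ran_def)
  have xy: "x \<noteq> y"
    using mx y by auto
  have ny: "m a \<noteq> Some y" for a
    using centre[of a y] y by auto
  have fib: "fibre m' a = (if a = s then insert x (fibre m a - {y}) else fibre m a)" for a
    using mx y xy by (auto simp: m'_def fibre_def)
  show card_fib: "card (fibre m' a) = card (fibre m a)" for a
  proof (cases "a = s")
    case True
    have "x \<notin> fibre m s - {y}" "y \<in> fibre m s"
      using mx y by (auto simp: fibre_def)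
    then have "card (insert x (fibre m s - {y})) = card (fibre m s)"
      using finite_fibre[OF m, of s] by (metis card_Suc_Diff1 card_insert_disjoint finite_Diff)
    then show ?thesis
      using True by (simp add: fib)
  qed (simp add: fib)
  have ms: "m s = None"
    using centre y by auto
  have "\<forall>a b. m' a = Some b \<longrightarrow> (a, b) \<in> E \<and> m' b = None"
    using edge centre xs ne nx ny ms by (auto simp: m'_def)
  then have m': "star_packing E n m'"
    using m by (simp add: star_packing_def card_fib)
  have dom': "dom m' = insert x (dom m) - {y}"
    by (auto simp: m'_def)
  \<comment> \<open>Centres are the vertices with nonempty fibre, and fibre sizes are
    unchanged.\<close>
  have ran': "ran m' = ran m"
  proof -
    have "fibre m' a = {} \<longleftrightarrow> fibre m a = {}" for a
      using card_fib[of a] finite_fibre[OF m, of a] finite_fibre[OF m', of a]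
      by (metis card_eq_0_iff)
    then show ?thesis
      unfolding ran_def fibre_def by auto
  qed
  have yran: "y \<notin> ran m"
    using ny by (auto simp: ran_def)
  then show "y \<notin> covered m'"
    by (simp add: covered_def dom' ran')
  have cov: "covered m' = insert x (covered m) - {y}"
    using yran by (auto simp: covered_def dom' ran')
  have "y \<in> covered m"
    using y by (auto simp: covered_def)
  then have "card (covered m') = card (covered m)"
    using x finite_covered[OF m] by (simp add: cov card_insert_if)
  then show "max_star_packing E n m'"
    using max m' by (simp add: max_star_packing_def)
qed

text \<open>The leaves together with the uncovered vertex form a fixed set, so non-leaves of
  \<open>m'\<close> other than \<open>x\<close> are non-leaves of \<open>m\<close>. By the last
  conjunct, a vertex changes its value only if some exchange sequence leaves it uncovered.\<close>

lemma alternating_invariant: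
  assumes max: "max_star_packing E n m" and u: "u \<notin> covered m"
    and alt: "alternating E m u m' x"
  shows "max_star_packing E n m' \<and> x \<notin> covered m' \<and> insert x (dom m') = insert u (dom m) \<and>
    (\<forall>s. card (fibre m' s) = card (fibre m s)) \<and>
    (\<forall>y. m' y = m y \<or> (\<exists>m''. alternating E m u m'' y))"
  using alt
proof induction
  case base
  show ?case
    using max u by auto
next
  case (step m' x s y)
  then have m': "max_star_packing E n m'" "x \<notin> covered m'" by auto
  note swap = max_star_packing_swap[OF m' step.hyps(2,3)]
  define m2 where "m2 = m'(x \<mapsto> s, y := None)"
  have "insert y (dom m2) = insert x (dom m')"
    using step.hyps(3) by (auto simp: m2_def)
  \<comment> \<open>Only \<open>x\<close> and \<open>y\<close> change their values, and both end an
    exchange sequence.\<close>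
  moreover have "m2 z = m z \<or> (\<exists>m''. alternating E m u m'' z)" for z
    using step.IH alternating.step[OF step.hyps] step.hyps(1) unfolding m2_def by (metis fun_upd_apply)
  ultimately show ?case
    using swap step.IH unfolding m2_def[symmetric] by simp
qed

text \<open>The set \<open>I\<close> consists of the vertices that can be left uncovered after a sequence of swaps
  starting from \<open>u\<close>. Its neighbours are centres of stars with \<open>n\<close> leaves all of which lie in \<open>I\<close>,
  and \<open>u\<close> is one further element.\<close>
lemma max_star_packing_deficient_set:
  assumes n: "n \<ge> 2" and max: "max_star_packing E n m" and u: "u \<in> V" "u \<notin> covered m"
  obtains I where "I \<subseteq> V" and "I \<inter> E `` I = {}" and "card I > n * card (E `` I)"
proof
  define I where "I = {x. \<exists>m'. alternating E m u m' x}"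
  have m: "star_packing E n m"
    using max by (simp add: max_star_packing_def)
  note inv = alternating_invariant[OF max u(2)]
  have I_dom: "I \<subseteq> insert u (dom m)"
    unfolding I_def using inv by blast
  have nbr: "s \<notin> insert u (dom m) \<and> card (fibre m s) = n \<and> fibre m s \<subseteq> I"
    if x: "x \<in> I" and xs: "(x, s) \<in> E" for x s
  proof -
    obtain m' where alt: "alternating E m u m' x"
      using x by (auto simp: I_def)
    note i = inv[OF alt]
    \<comment> \<open>Maximality is applied to \<open>m'\<close>, which leaves \<open>x\<close>
      uncovered; \<open>m\<close> itself may cover \<open>x\<close>.\<close>
    have full: "m' s = None" "card (fibre m' s) = n"
      using max_star_packing_neighbour_full[OF n _ _ xs, of m'] i by auto
    have "s \<noteq> x"
      using xs irrefl_E by (auto simp: irrefl_def)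
    then have "s \<notin> insert u (dom m)"
      using i full(1) by (metis domIff insertE)
    \<comment> \<open>Either \<open>y\<close> is still a leaf of \<open>s\<close> in
      \<open>m'\<close>, and one more exchange frees it, or its value has changed and it is in
      \<open>I\<close> by the invariant.\<close>
    moreover have "y \<in> I" if "y \<in> fibre m s" for y
      using that i alternating.step[OF alt xs, of y] unfolding I_def fibre_def
      by (metis (mono_tags, lifting) mem_Collect_eq)
    ultimately show ?thesis
      using i full(2) by auto
  qed
  show IV: "I \<subseteq> V"
    using I_dom u(1) covered_subset[OF m] by (auto simp: covered_def)
  show "I \<inter> E `` I = {}"
    using nbr I_dom by blast
  have fin: "finite I" "finite (E `` I)"
    using IV finite_V E_subset by (auto intro: finite_subset[of _ V])
  \<comment> \<open>The leaf sets of the neighbours are disjoint and have \<open>n\<close> elements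
    each; their union lies in \<open>I\<close> and misses \<open>u\<close>.\<close>
  have "n * card (E `` I) = card (\<Union>s \<in> E `` I. fibre m s)"
  proof (subst card_UN_disjoint)
    show "\<forall>s\<in>E `` I. finite (fibre m s)"
      using finite_fibre[OF m] by blast
    show "\<forall>s\<in>E `` I. \<forall>t\<in>E `` I. s \<noteq> t \<longrightarrow> fibre m s \<inter> fibre m t = {}"
      by (auto simp: fibre_def)
    have "(\<Sum>s\<in>E `` I. card (fibre m s)) = (\<Sum>s\<in>E `` I. n)"
      using nbr by (intro sum.cong) auto
    then show "n * card (E `` I) = (\<Sum>s\<in>E `` I. card (fibre m s))"
      by simp
  qed (use fin in auto)
  also have "\<dots> < card I"
  proof (rule psubset_card_mono[OF fin(1)])
    have "u \<in> I"
      using alternating.base[of E m u] by (auto simp: I_def)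
    moreover have "u \<notin> (\<Union>s \<in> E `` I. fibre m s)"
      using u(2) by (auto simp: fibre_def covered_def)
    ultimately show "(\<Union>s \<in> E `` I. fibre m s) \<subset> I"
      using nbr by blast
  qed
  finally show "card I > n * card (E `` I)" .
qed

text \<open>Sufficiency in the theorem of Las Vergnas, Amahashi and Kano on star factors.\<close>
theorem star_packing_covering_exists:
  assumes n: "n \<ge> 2"
    and expand: "\<And>I. I \<subseteq> V \<Longrightarrow> I \<inter> E `` I = {} \<Longrightarrow> card I \<le> n * card (E `` I)"
  obtains m where "star_packing E n m" "covered m = V"
proof -
  obtain m where max: "max_star_packing E n m"
    using max_star_packing_exists by blast
  then have m: "star_packing E n m"
    by (simp add: max_star_packing_def)
  have "V \<subseteq> covered m"
    using max_star_packing_deficient_set[OF n max] expand by (metis leD subsetI)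
  then show ?thesis
    using that m covered_subset[OF m] by blast
qed

end

section \<open>Adjacency in graphs and expansion of independent sets\<close>

context graph
begin

lemma finite_simple_relation_arcs_ends: "finite_simple_relation (verts G) (arcs_ends G)"
  by unfold_locales
    (use sym_arcs no_loops in \<open>auto simp: symmetric_def arcs_ends_conv irrefl_def\<close>)

lemma graph_spanning_arc_subset:
  assumes A: "A \<subseteq> arcs G"
    and sym: "\<And>x y. (x, y) \<in> arc_to_ends G ` A \<Longrightarrow> (y, x) \<in> arc_to_ends G ` A"
  shows "graph (G\<lparr>arcs := A\<rparr>)" and "spanning (G\<lparr>arcs := A\<rparr>) G"
proof -
  let ?H = "G\<lparr>arcs := A\<rparr>"
  have fin: "finite A"
    using A finite_arcs finite_subset by blast
  interpret H: digraph ?H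
    using A by unfold_locales
      (auto simp: fin arc_to_ends_def subset_iff dest: no_loops intro: no_multi_arcs)
  show "graph ?H"
    using sym by (intro H.graphI) (auto simp: symmetric_def arcs_ends_def arc_to_ends_def intro!: symI)
  show "spanning ?H G"
    using A H.wf_digraph_axioms wf_digraph_axioms
    by (simp add: spanning_def subgraph_def compatible_def)
qed

lemma graphI_induced: "induced_subgraph H G \<Longrightarrow> graph H"
  using digraphI_induced induced_graph_imp_symmetric[OF sym_arcs] digraph.graphI by blast

lemma arcs_ends_induced:
  assumes "induced_subgraph H G"
  shows "arcs_ends H = arcs_ends G \<inter> verts H \<times> verts H"
  using assms by (auto simp: induced_subgraph_def subgraph_def compatible_def arcs_ends_conv)

lemma out_degree_eq_card_neighbours: "out_degree G v = card (arcs_ends G `` {v})"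
proof -
  have "arcs_ends G `` {v} = head G ` out_arcs G v"
    by (auto simp: arcs_ends_conv)
  moreover have "inj_on (head G) (out_arcs G v)"
    by (rule inj_onI) (auto intro: no_multi_arcs simp: arc_to_ends_def)
  ultimately show ?thesis
    by (simp add: out_degree_def card_image)
qed

text \<open>Any \<open>r\<close> pairwise non-adjacent neighbours of \<open>s\<close> would induce,
  together with \<open>s\<close>, a forbidden star.\<close>

lemma star_free_card_independent_neighbours:
  assumes free: "star_free r G" and s: "s \<in> verts G" and A: "A \<subseteq> arcs_ends G `` {s}" and indep: "A \<inter> arcs_ends G `` A = {}"
  shows "card A < r"
proof (rule ccontr)
  assume "\<not> card A < r"
  then obtain B where B: "B \<subseteq> A" "card B = r"
    by (meson not_less obtain_subset_with_card_n)
  define H where "H = G \<restriction> insert s B"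
  have adj: "(s, b) \<in> arcs_ends G" "(b, s) \<in> arcs_ends G" "b \<noteq> s" "b \<in> verts G" if "b \<in> B" for b
    using that A B adj_not_same adj_in_verts graph_symmetric by blast+
  have ind: "induced_subgraph H G"
    unfolding H_def using s adj by (intro induced_induce) auto
  have "(a, b) \<notin> arcs_ends G" if "a \<in> B" "b \<in> B" for a b
    using that B(1) indep by blast
  then have "arcs_ends H = {s} \<times> B \<union> B \<times> {s}"
    unfolding arcs_ends_induced[OF ind] using adj adj_not_same by (auto simp: H_def)
  moreover have "verts H = {s} \<union> B" "{s} \<inter> B = {}" "card {s} = 1"
    using adj by (auto simp: H_def)
  ultimately have "K\<^bsub>1,r\<^esub> H"
    unfolding complete_bipartite_digraph_def using graphI_induced[OF ind] B(2) by blast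
  then show False
    using free ind by (auto simp: star_free_def)
qed

lemma star_free_independent_expansion:
  assumes free: "star_free r G" and deg: "\<And>v. v \<in> verts G \<Longrightarrow> d \<le> out_degree G v"
    and d: "d > 0" "r - 1 \<le> d * n"
    and I: "I \<subseteq> verts G" and indep: "I \<inter> arcs_ends G `` I = {}"
  shows "card I \<le> n * card (arcs_ends G `` I)"
proof -
  let ?S = "arcs_ends G `` I"
  have S: "?S \<subseteq> verts G"
    using adj_in_verts by blast
  have fin: "finite I" "finite ?S"
    using I S finite_verts finite_subset by blast+
  have "d * card I = (\<Sum>x\<in>I. d)"
    by simp
  also have "\<dots> \<le> (\<Sum>x\<in>I. card {s \<in> ?S. (x, s) \<in> arcs_ends G})"
  proof (rule sum_mono)
    fix x assume x: "x \<in> I"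
    then have "{s \<in> ?S. (x, s) \<in> arcs_ends G} = arcs_ends G `` {x}"
      by blast
    then show "d \<le> card {s \<in> ?S. (x, s) \<in> arcs_ends G}"
      using deg x I by (auto simp: out_degree_eq_card_neighbours)
  qed
  \<comment> \<open>The edges between \<open>I\<close> and its neighbourhood are counted from the
    other side.\<close>
  also have "\<dots> = (\<Sum>s\<in>?S. card {x \<in> I. (x, s) \<in> arcs_ends G})"
    using fin by (intro sum_multicount_gen) auto
  also have "\<dots> \<le> (\<Sum>s\<in>?S. d * n)"
  proof (rule sum_mono)
    fix s assume "s \<in> ?S"
    then have "card {x \<in> I. (x, s) \<in> arcs_ends G} < r"
      using indep S graph_symmetric by (intro star_free_card_independent_neighbours[OF free, of s]) blast+
    then show "card {x \<in> I. (x, s) \<in> arcs_ends G} \<le> d * n"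
      using d(2) by linarith
  qed
  also have "\<dots> = d * (n * card ?S)"
    by simp
  finally show ?thesis
    using d(1) by simp
qed

section \<open>Components of a packing and the resulting factor\<close>

lemma sccs_verts_eq_reachable:
  assumes C: "C \<in> sccs" and v: "v \<in> verts C"
  shows "verts C = {w. v \<rightarrow>\<^sup>* w}"
  \<comment> \<open>Reachability is symmetric in a graph, so mutual reachability reduces to one
    direction.\<close>
  using in_sccs_vertsI_sccs[of "verts C"] C v symmetric_reachable'
  unfolding in_sccs_verts_conv_reachable by blast

end

text \<open>A leaf is adjacent only to its centre and a centre only to its leaves, so each component
  is one star of the packing.\<close>

lemma star_packing_component:
  assumes "graph H" and ends: "arcs_ends H = {(x, y). m x = Some y \<or> m y = Some x}"
    and m: "star_packing E n m" and cov: "covered m = verts H"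
    and C: "C \<in> pre_digraph.sccs H"
  shows "\<exists>k \<in> {1..n}. K\<^bsub>1,k\<^esub> C"
proof -
  interpret graph H by fact
  have centre: "m b = None" if "m a = Some b" for a b
    using m that by (auto simp: star_packing_def)
  have ind: "induced_subgraph C H"
    using C by (rule in_sccs_imp_induced)
  obtain v where v: "v \<in> verts C"
    using C unfolding sccs_def strongly_connected_def by blast
  have "v \<in> verts H"
    using v ind by (auto simp: induced_subgraph_def subgraph_def)
  \<comment> \<open>The centre of the star containing \<open>v\<close>.\<close>
  define c where "c = (case m v of None \<Rightarrow> v | Some s \<Rightarrow> s)"
  have c: "c \<in> verts C"
  proof (cases "m v")
    case (Some s)
    then have "v \<rightarrow>\<^bsub>H\<^esub> s"
      by (simp add: ends)
    then show ?thesis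
      using Some sccs_verts_eq_reachable[OF C v] by (auto simp: c_def)
  qed (simp add: c_def v)
  have mc: "m c = None"
    using centre by (auto simp: c_def split: option.splits)
  have cH: "c \<in> verts H"
    using c ind by (auto simp: induced_subgraph_def subgraph_def)
  have "w \<in> insert c (fibre m c)" if "c \<rightarrow>\<^sup>*\<^bsub>H\<^esub> w" for w
    using that
  proof (induction rule: reachable_induct)
    case (step x y)
    then show ?case
      using mc centre by (auto simp: ends fibre_def)
  qed simp
  moreover have "c \<rightarrow>\<^sup>*\<^bsub>H\<^esub> w" if "w \<in> fibre m c" for w
    using that by (intro reachable_adjI) (simp add: ends fibre_def)
  ultimately have verts: "verts C = {c} \<union> fibre m c"
    using sccs_verts_eq_reachable[OF C c] cH by auto
  have disj: "{c} \<inter> fibre m c = {}"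
    using mc by (simp add: fibre_def)
  have "arcs_ends C = {c} \<times> fibre m c \<union> fibre m c \<times> {c}"
    unfolding arcs_ends_induced[OF ind] verts ends using mc centre by (auto simp: fibre_def)
  then have "K\<^bsub>1,card (fibre m c)\<^esub> C"
    unfolding complete_bipartite_digraph_def using graphI_induced[OF ind] verts disj
    by (metis card_1_singleton_iff One_nat_def)
  \<comment> \<open>\<open>c\<close> is covered but is not a leaf, so it has a leaf; this excludes
    an isolated vertex.\<close>
  moreover have "fibre m c \<noteq> {}"
    using cH mc by (auto simp: cov[symmetric] covered_def ran_def fibre_def)
  moreover have "finite (fibre m c)"
    by (rule finite_subset[OF _ finite_verts]) (auto simp: fibre_def cov[symmetric] covered_def)
  ultimately show ?thesis
    using m by (intro bexI[of _ "card (fibre m c)"]) (auto simp: star_packing_def Suc_le_eq card_gt_0_iff)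
qed

lemma (in graph) star_factor_of_star_packing:
  assumes m: "star_packing (arcs_ends G) n m" and cov: "covered m = verts G"
  shows "\<exists>H. is_star_factor n H G"
proof -
  \<comment> \<open>Both arcs of each packing edge are selected, which keeps the subgraph
    symmetric.\<close>
  define A where "A = {e \<in> arcs G. m (tail G e) = Some (head G e) \<or> m (head G e) = Some (tail G e)}"
  define H where "H = G\<lparr>arcs := A\<rparr>"
  have "arc_to_ends G ` A = {(x, y) \<in> arcs_ends G. m x = Some y \<or> m y = Some x}"
    by (auto simp: A_def arcs_ends_def arc_to_ends_def)
  also have "\<dots> = {(x, y). m x = Some y \<or> m y = Some x}"
    using m graph_symmetric by (auto simp: star_packing_def)
  finally have A: "arc_to_ends G ` A = {(x, y). m x = Some y \<or> m y = Some x}" .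
  have "A \<subseteq> arcs G"
    by (auto simp: A_def)
  moreover have "(y, x) \<in> arc_to_ends G ` A" if "(x, y) \<in> arc_to_ends G ` A" for x y
    using that unfolding A by auto
  ultimately have H: "graph H" "spanning H G"
    using graph_spanning_arc_subset unfolding H_def by blast+
  have "arcs_ends H = {(x, y). m x = Some y \<or> m y = Some x}"
    using A by (simp add: H_def arcs_ends_def arc_to_ends_def)
  then have "\<forall>C \<in> pre_digraph.sccs H. \<exists>k \<in> {1..n}. K\<^bsub>1,k\<^esub> C"
    using star_packing_component[OF H(1) _ m] cov by (simp add: H_def)
  then show ?thesis
    using H unfolding is_star_factor_def is_factor_def by blast
qed

theorem theorem3:
  fixes r n :: nat and G :: "('a, 'b) pre_digraph"
  assumes "r \<ge> 3" and "n \<ge> 2"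
    and "graph G"
    and "star_free r G"
    and "min_degree G \<ge> (r + n - 2) div n"
  shows "\<exists>H. is_star_factor n H G"
proof -
  interpret graph G by fact
  interpret finite_simple_relation "verts G" "arcs_ends G"
    by (rule finite_simple_relation_arcs_ends)
  define d where "d = (r + n - 2) div n"
  have "n \<le> r + n - 2"
    using assms(1) by simp
  then have d_pos: "d > 0"
    using assms(2) by (simp add: d_def div_greater_zero_iff)
  \<comment> \<open>The remainder is at most \<open>n - 1\<close>, so \<open>r + n - 2\<close> is at
    most \<open>d * n + n - 1\<close>.\<close>
  have "(r + n - 2) mod n < n"
    using assms(2) by simp
  then have d_n: "r - 1 \<le> d * n"
    using div_mult_mod_eq[of "r + n - 2" n] assms(1) unfolding d_def by linarith
  \<comment> \<open>The bound is claimed only at vertices, so the unspecified minimum degree of the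
    graph without vertices does no harm.\<close>
  have deg: "d \<le> out_degree G v" if "v \<in> verts G" for v
  proof -
    have "min_degree G \<le> out_degree G v"
      unfolding min_degree_def using that by simp
    then show ?thesis
      using assms(5) by (simp add: d_def)
  qed
  obtain m where "star_packing (arcs_ends G) n m" "covered m = verts G"
    using star_packing_covering_exists[OF assms(2) star_free_independent_expansion[OF assms(4) deg d_pos d_n]]
    by blast
  then show ?thesis
    by (rule star_factor_of_star_packing)
qed

end
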